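(* Consider the stochastic iteratively regularized Gauss-Newton iteration described in the context. Let the variational source condition (with concave index function $\varphi$) and the tangential cone condition (with constants $C_{\mathrm{tc}}\ge1$, $\eta>0$), as stated in the context, hold, and assume that $u_n\in D(F)$ is well defined. Then $u_{n+1}$ satisfies the error decomposition $$\alpha_n d_{n+1}+\frac{1}{2C_{\mathrm{tc}}}t_{n+1}\le\mathbb E\left[\partial\widetilde{\mathrm{err}}_n\right]+\alpha_n\Psi(2C_{\mathrm{tc}}\alpha_n)+2\eta\,t_n,$$ where $d_n=\mathbb E\left[\|u_n-u^\dagger\|_{\mathcal X}^2\right]$, $t_n=\frac12\mathbb E\left[\|F(u_n)-y^\dagger\|_{\mathcal Y}^2\right]$, and $$\Psi(2C_{\mathrm{tc}}\alpha_n):=(-\varphi)^*\left(-\frac{1}{2C_{\mathrm{tc}}\alpha_n}\right)=\sup_{\tau\ge0}\left[\varphi(\tau)-\frac{\tau}{2C_{\mathrm{tc}}\alpha_n}\right],$$ with $(-\varphi)^*$ the Fenchel conjugate of the convex function $-\varphi$.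
   Context: Setting. $\mathcal X,\mathcal Y$ are real Hilbert spaces, $F:D(F)\subseteq\mathcal X\to\mathcal Y$ is Fréchet differentiable with derivative $F'[u]$ at $u$, $u^\dagger\in D(F)$ and $y^\dagger=F(u^\dagger)$. For each $n\ge 0$ there are a regularization parameter $\alpha_n>0$, a random sketching operator $\mathcal P_n:\mathcal Y\to\mathcal Y_p$, where $\mathcal Y_p$ (the projected observation space) is regarded as a Hilbert subspace of $\mathcal Y$, and a point $Z_n\in\mathcal Y_p$. For $g\in\mathcal Y$ put $$\mathcal S_n(g)=\tfrac12\|g\|_{\mathcal Y}^2-\langle g,Z_n\rangle,\qquad \tilde{\mathcal S}_n(g)=\tfrac12\|\mathcal P_n[g]\|_{\mathcal Y_p}^2-\langle Z_n,\mathcal P_n[g]\rangle.$$ Given the initial guess $u_0\in\mathcal X$, the iterates are $$u_{n+1}\in\operatorname{argmin}_{u\in\mathcal X}\left[\tilde{\mathcal S}_n\big(F(u_n)+F'[u_n](u-u_n)\big)+\alpha_n\|u-u_0\|_{\mathcal X}^2\right].$$ The iterates are assumed to be well defined and to lie in $D(F)$, and all expectations (over all randomness) are assumed to exist. Notation. $F_n^\dagger:=F(u_n)+F'[u_n](u^\dagger-u_n)$ and $F_n^{n+1}:=F(u_n)+F'[u_n](u_{n+1}-u_n)$. For $g\in\mathcal Y$, $$\mathrm{err}_n(g):=\tfrac12\|g-y^\dagger\|_{\mathcal Y}^2-\big(\mathcal S_n(g)-\mathcal S_n(y^\dagger)\big),\qquad \widetilde{\mathrm{err}}_n(g):=\mathrm{err}_n(g)+\big(\mathcal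 S_n(g)-\tilde{\mathcal S}_n(g)\big),$$ and $\partial\widetilde{\mathrm{err}}_n:=\widetilde{\mathrm{err}}_n(F_n^{n+1})-\widetilde{\mathrm{err}}_n(F_n^\dagger)$. Variational source condition. There is a concave index function $\varphi:[0,\infty)\to[0,\infty)$ (i.e. $\varphi(0)=0$ and $\varphi$ increases to $\infty$) such that for all $u\in D(F)$ $$\|u-u^\dagger\|_{\mathcal X}^2\le\|u-u_0\|_{\mathcal X}^2-\|u^\dagger-u_0\|_{\mathcal X}^2+\varphi\left(\tfrac12\|F(u)-F(u^\dagger)\|_{\mathcal Y}^2\right).$$ Tangential cone condition. There are constants $C_{\mathrm{tc}}\ge 1$ and $\eta>0$ (sufficiently small; no quantitative threshold is imposed) such that for all $u,v\in D(F)$ $$\tfrac1{C_{\mathrm{tc}}}\|F(v)-y^\dagger\|_{\mathcal Y}^2-\eta\|F(u)-y^\dagger\|_{\mathcal Y}^2\le\|F(u)+F'[u](v-u)-y^\dagger\|_{\mathcal Y}^2\le C_{\mathrm{tc}}\|F(v)-y^\dagger\|_{\mathcal Y}^2+\eta\|F(u)-y^\dagger\|_{\mathcal Y}^2.$$ *)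

theory Defs
  imports "HOL-Probability.Probability"
begin

text \<open>
  All functionals below take one realization of the random data as arguments: \<open>P\<close> is a
  realization of the sketching operator and \<open>Z\<close> one of the data point. The projected
  observation space is a closed subspace of the observation space and carries the inherited
  norm and inner product.
\<close>

definition data_fidelity :: "'y::real_inner \<Rightarrow> 'y \<Rightarrow> real" where
  "data_fidelity Z g = 1/2 * (norm g)\<^sup>2 - g \<bullet> Z"

definition sketched_fidelity :: "('y::real_inner \<Rightarrow> 'y) \<Rightarrow> 'y \<Rightarrow> 'y \<Rightarrow> real" where
  "sketched_fidelity P Z g = 1/2 * (norm (P g))\<^sup>2 - Z \<bullet> P g"

definition err :: "'y::real_inner \<Rightarrow> 'y \<Rightarrow> 'y \<Rightarrow> real" where
  "err yd Z g = 1/2 * (norm (g - yd))\<^sup>2 - (data_fidelity Z g - data_fidelity Z yd)"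

definition sketched_err :: "'y::real_inner \<Rightarrow> ('y \<Rightarrow> 'y) \<Rightarrow> 'y \<Rightarrow> 'y \<Rightarrow> real" where
  "sketched_err yd P Z g = err yd Z g + (data_fidelity Z g - sketched_fidelity P Z g)"

definition linearization ::
  "('x::real_vector \<Rightarrow> 'y::real_vector) \<Rightarrow> ('x \<Rightarrow> 'x \<Rightarrow> 'y) \<Rightarrow> 'x \<Rightarrow> 'x \<Rightarrow> 'y" where
  "linearization F F' u v = F u + F' u (v - u)"

definition sketched_err_diff ::
  "('x::real_vector \<Rightarrow> 'y::real_inner) \<Rightarrow> ('x \<Rightarrow> 'x \<Rightarrow> 'y) \<Rightarrow> 'x \<Rightarrow>
   ('y \<Rightarrow> 'y) \<Rightarrow> 'y \<Rightarrow> 'x \<Rightarrow> 'x \<Rightarrow> real" where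
  "sketched_err_diff F F' ud P Z u u_next =
     sketched_err (F ud) P Z (linearization F F' u u_next)
     - sketched_err (F ud) P Z (linearization F F' u ud)"

definition irgnm_objective ::
  "('x::real_normed_vector \<Rightarrow> 'y::real_inner) \<Rightarrow> ('x \<Rightarrow> 'x \<Rightarrow> 'y) \<Rightarrow> 'x \<Rightarrow> real \<Rightarrow>
   ('y \<Rightarrow> 'y) \<Rightarrow> 'y \<Rightarrow> 'x \<Rightarrow> 'x \<Rightarrow> real" where
  "irgnm_objective F F' u0 a P Z u v =
     sketched_fidelity P Z (linearization F F' u v) + a * (norm (v - u0))\<^sup>2"

text \<open>Only the values of \<open>\<phi>\<close> on \<open>[0, \<infinity>)\<close> matter.\<close>

definition concave_index_function :: "(real \<Rightarrow> real) \<Rightarrow> bool" where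
  "concave_index_function \<phi> \<longleftrightarrow>
     (\<forall>\<tau>\<ge>0. 0 \<le> \<phi> \<tau>) \<and> \<phi> 0 = 0 \<and> mono_on {0..} \<phi> \<and> filterlim \<phi> at_top at_top \<and>
     concave_on {0..} \<phi>"

definition variational_source_condition ::
  "('x::real_normed_vector \<Rightarrow> 'y::real_normed_vector) \<Rightarrow> 'x set \<Rightarrow> 'x \<Rightarrow> 'x \<Rightarrow> (real \<Rightarrow> real) \<Rightarrow> bool"
  where
  "variational_source_condition F D ud u0 \<phi> \<longleftrightarrow>
     (\<forall>u\<in>D. (norm (u - ud))\<^sup>2
        \<le> (norm (u - u0))\<^sup>2 - (norm (ud - u0))\<^sup>2 + \<phi> (1/2 * (norm (F u - F ud))\<^sup>2))"

definition tangential_cone_condition ::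
  "('x::real_vector \<Rightarrow> 'y::real_normed_vector) \<Rightarrow> ('x \<Rightarrow> 'x \<Rightarrow> 'y) \<Rightarrow> 'x set \<Rightarrow> 'y \<Rightarrow>
   real \<Rightarrow> real \<Rightarrow> bool" where
  "tangential_cone_condition F F' D yd C \<eta> \<longleftrightarrow>
     (\<forall>u\<in>D. \<forall>v\<in>D.
        1/C * (norm (F v - yd))\<^sup>2 - \<eta> * (norm (F u - yd))\<^sup>2
          \<le> (norm (linearization F F' u v - yd))\<^sup>2 \<and>
        (norm (linearization F F' u v - yd))\<^sup>2
          \<le> C * (norm (F v - yd))\<^sup>2 + \<eta> * (norm (F u - yd))\<^sup>2)"

definition fenchel_conjugate :: "(real \<Rightarrow> ereal) \<Rightarrow> real \<Rightarrow> ereal" where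
  "fenchel_conjugate f s = (SUP \<tau>. ereal (s * \<tau>) - f \<tau>)"

text \<open>\<open>-\<phi>\<close> as an extended-valued convex function on the whole line.\<close>

definition neg_index :: "(real \<Rightarrow> real) \<Rightarrow> real \<Rightarrow> ereal" where
  "neg_index \<phi> \<tau> = (if 0 \<le> \<tau> then ereal (- \<phi> \<tau>) else \<infinity>)"

text \<open>The value is \<open>\<infinity>\<close> when the supremum is not finite, e.g. for linear \<open>\<phi>\<close> and large \<open>\<beta>\<close>.\<close>

definition Psi :: "(real \<Rightarrow> real) \<Rightarrow> real \<Rightarrow> ereal" where
  "Psi \<phi> \<beta> = fenchel_conjugate (neg_index \<phi>) (- 1 / \<beta>)"

definition mean_sq_error :: "'w measure \<Rightarrow> 'x::real_normed_vector \<Rightarrow> ('w \<Rightarrow> 'x) \<Rightarrow> real" where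
  "mean_sq_error M ud U = prob_space.expectation M (\<lambda>\<omega>. (norm (U \<omega> - ud))\<^sup>2)"

definition mean_sq_residual ::
  "'w measure \<Rightarrow> ('x \<Rightarrow> 'y::real_normed_vector) \<Rightarrow> 'y \<Rightarrow> ('w \<Rightarrow> 'x) \<Rightarrow> real" where
  "mean_sq_residual M F yd U = 1/2 * prob_space.expectation M (\<lambda>\<omega>. (norm (F (U \<omega>) - yd))\<^sup>2)"

end

theory Submission
  imports Defs
begin

text \<open>
  Compare the objective at the minimizer \<open>u\<^sub>n\<^sub>+\<^sub>1\<close> with its value at the exact solution; the
  tangential cone condition turns linearized residuals into true ones, and the variational
  source condition turns the penalty difference into the squared error. The source condition
  costs \<open>\<alpha>\<^sub>n \<phi>(\<tau>)\<close> with \<open>\<tau>\<close> half the squared new residual. Half of the available \<open>\<tau> / C\<close> is given up to absorb it,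
  because \<open>\<alpha>\<^sub>n \<phi>(\<tau>) - \<tau> / (2 C)\<close> is at most \<open>\<alpha>\<^sub>n \<Psi>(2 C \<alpha>\<^sub>n)\<close>. The estimate holds for almost
  every realization, and one takes expectations.
\<close>

text \<open>Every \<tau> < 0 contributes minus infinity, because \<open>neg_index\<close> is
  infinite there; hence the supremum over the whole line in the conjugate is already attained by
  restricting to the half-line.\<close>

lemma Psi_eq_SUP:
  "Psi \<phi> \<beta> = (SUP \<tau>\<in>{0..}. ereal (\<phi> \<tau> - \<tau> / \<beta>))"
  unfolding Psi_def fenchel_conjugate_def
proof (rule antisym)
  show "(SUP \<tau>. ereal (- 1 / \<beta> * \<tau>) - neg_index \<phi> \<tau>) \<le> (SUP \<tau>\<in>{0..}. ereal (\<phi> \<tau> - \<tau> / \<beta>))"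
  proof (rule SUP_least)
    fix \<tau> :: real
    show "ereal (- 1 / \<beta> * \<tau>) - neg_index \<phi> \<tau> \<le> (SUP \<tau>\<in>{0..}. ereal (\<phi> \<tau> - \<tau> / \<beta>))"
    proof (cases "0 \<le> \<tau>")
      case True
      then show ?thesis
        by (intro SUP_upper2[of \<tau>]) (auto simp: neg_index_def)
    qed (simp add: neg_index_def)
  qed
  show "(SUP \<tau>\<in>{0..}. ereal (\<phi> \<tau> - \<tau> / \<beta>)) \<le> (SUP \<tau>. ereal (- 1 / \<beta> * \<tau>) - neg_index \<phi> \<tau>)"
  proof (rule SUP_least)
    fix \<tau> :: real assume "\<tau> \<in> {0..}"
    then show "ereal (\<phi> \<tau> - \<tau> / \<beta>) \<le> (SUP \<tau>. ereal (- 1 / \<beta> * \<tau>) - neg_index \<phi> \<tau>)"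
      by (intro SUP_upper2[of \<tau>]) (auto simp: neg_index_def)
  qed
qed

text \<open>The Fenchel-Young inequality for the convex function -\<phi> at slope
  -1/\<beta>.\<close>

lemma Psi_upper:
  assumes "0 \<le> \<tau>"
  shows "ereal (\<phi> \<tau> - \<tau> / \<beta>) \<le> Psi \<phi> \<beta>"
  unfolding Psi_eq_SUP using assms by (intro SUP_upper) auto

text \<open>The point \<tau> = 0 contributes 0 to the supremum. This excludes the value minus
  infinity, so only a finite and an infinite case remain in the theorem.\<close>

lemma Psi_nonneg:
  assumes "\<phi> 0 = 0"
  shows "0 \<le> Psi \<phi> \<beta>"
  using Psi_upper[of 0 \<phi> \<beta>] assms by (simp add: zero_ereal_def)

text \<open>The unsketched fidelity cancels within \<open>sketched_err\<close>, and its value at the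
  exact data cancels in the difference. What survives is the sketched fidelity, the very term that
  the iteration minimizes.\<close>

lemma sketched_err_diff_eq:
  "sketched_err_diff F F' ud P Z u v =
     1/2 * (norm (linearization F F' u v - F ud))\<^sup>2
     - 1/2 * (norm (linearization F F' u ud - F ud))\<^sup>2
     + sketched_fidelity P Z (linearization F F' u ud)
     - sketched_fidelity P Z (linearization F F' u v)"
  unfolding sketched_err_diff_def sketched_err_def err_def by simp

text \<open>The deterministic core, for one realization. A real bound \<open>p\<close> replaces the
  extended-valued \<open>Psi\<close>, which keeps the argument within linear real
  arithmetic.\<close>

lemma irgnm_step_estimate:
  fixes F :: "'x::real_normed_vector \<Rightarrow> 'y::real_inner"
  assumes "ud \<in> D" "u \<in> D" "v \<in> D" and "0 < a" "0 < C"
    and min: "irgnm_objective F F' u0 a P Z u v \<le> irgnm_objective F F' u0 a P Z u ud"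
    and vsc: "variational_source_condition F D ud u0 \<phi>"
    and tcc: "tangential_cone_condition F F' D (F ud) C \<eta>"
    and conj: "\<And>\<tau>. 0 \<le> \<tau> \<Longrightarrow> \<phi> \<tau> - \<tau> / (2 * C * a) \<le> p"
  shows "a * (norm (v - ud))\<^sup>2 + 1 / (2 * C) * (1/2 * (norm (F v - F ud))\<^sup>2)
    \<le> sketched_err_diff F F' ud P Z u v + a * p + 2 * \<eta> * (1/2 * (norm (F u - F ud))\<^sup>2)"
proof -
  define T where "T = 1/2 * (norm (F v - F ud))\<^sup>2"
  define t where "t = 1/2 * (norm (F u - F ud))\<^sup>2"
  have "(norm (v - ud))\<^sup>2 \<le> (norm (v - u0))\<^sup>2 - (norm (ud - u0))\<^sup>2 + \<phi> T"
    using vsc \<open>v \<in> D\<close> unfolding variational_source_condition_def T_def by blast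
  then have source: "a * (norm (v - ud))\<^sup>2
      \<le> a * (norm (v - u0))\<^sup>2 - a * (norm (ud - u0))\<^sup>2 + a * \<phi> T"
    using mult_left_mono[of _ _ a] \<open>0 < a\<close> by (fastforce simp: algebra_simps)
  have "1/C * (norm (F v - F ud))\<^sup>2 - \<eta> * (norm (F u - F ud))\<^sup>2
      \<le> (norm (linearization F F' u v - F ud))\<^sup>2"
    using tcc \<open>u \<in> D\<close> \<open>v \<in> D\<close> unfolding tangential_cone_condition_def by blast
  then have lower: "T / C - \<eta> * t \<le> 1/2 * (norm (linearization F F' u v - F ud))\<^sup>2"
    unfolding T_def t_def by (simp add: field_simps)
  \<comment> \<open>The upper cone bound is taken at the exact solution, where the term with factor
    \<open>C\<close> vanishes.\<close>
  have "(norm (linearization F F' u ud - F ud))\<^sup>2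
      \<le> C * (norm (F ud - F ud))\<^sup>2 + \<eta> * (norm (F u - F ud))\<^sup>2"
    using tcc \<open>u \<in> D\<close> \<open>ud \<in> D\<close> unfolding tangential_cone_condition_def by blast
  then have upper: "1/2 * (norm (linearization F F' u ud - F ud))\<^sup>2 \<le> \<eta> * t"
    unfolding t_def by simp
  have "\<phi> T - T / (2 * C * a) \<le> p"
    by (rule conj) (simp add: T_def)
  \<comment> \<open>The slope contains \<open>a\<close> in its denominator, so this scaling leaves
    exactly half of \<open>T / C\<close>.\<close>
  then have "a * (\<phi> T - T / (2 * C * a)) \<le> a * p"
    using \<open>0 < a\<close> by (intro mult_left_mono) auto
  then have conj': "a * \<phi> T - 1/2 * (T / C) \<le> a * p"
    using \<open>0 < a\<close> by (simp add: right_diff_distrib mult.commute)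
  \<comment> \<open>One \<open>\<eta> * t\<close> comes from \<open>lower\<close> and one from
    \<open>upper\<close>, whence the factor 2.\<close>
  have "a * (norm (v - ud))\<^sup>2 + 1/2 * (T / C) \<le> sketched_err_diff F F' ud P Z u v + a * p + 2 * (\<eta> * t)"
    using min source lower upper conj' unfolding irgnm_objective_def sketched_err_diff_eq
    by linarith
  then show ?thesis
    unfolding T_def t_def by (simp add: mult.commute)
qed

theorem lemma4p4:
  fixes M :: "'w measure"
    and F :: "'x::{real_inner, complete_space} \<Rightarrow> 'y::{real_inner, complete_space}"
    and F' :: "'x \<Rightarrow> 'x \<Rightarrow> 'y"
    and D :: "'x set"
    and ud u0 :: 'x
    and yd :: 'y
    and Yp :: "'y set"
    and \<alpha> :: "nat \<Rightarrow> real"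
    and P :: "nat \<Rightarrow> 'w \<Rightarrow> 'y \<Rightarrow> 'y"
    and Z :: "nat \<Rightarrow> 'w \<Rightarrow> 'y"
    and u :: "nat \<Rightarrow> 'w \<Rightarrow> 'x"
    and \<phi> :: "real \<Rightarrow> real"
    and C \<eta> :: real
    and n :: nat
  assumes "prob_space M"
    and "\<And>v. v \<in> D \<Longrightarrow> (F has_derivative F' v) (at v within D)"
    and "ud \<in> D" and "yd = F ud"
    and "subspace Yp" and "closed Yp"
    and "\<And>k. \<alpha> k > 0"
    and "\<And>k g. (\<lambda>\<omega>. P k \<omega> g) \<in> borel_measurable M"
    and "\<And>k \<omega> g. \<omega> \<in> space M \<Longrightarrow> P k \<omega> g \<in> Yp"
    and "\<And>k. Z k \<in> borel_measurable M"
    and "\<And>k \<omega>. \<omega> \<in> space M \<Longrightarrow> Z k \<omega> \<in> Yp"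
    and "\<And>k. u k \<in> borel_measurable M"
    and "\<And>\<omega>. \<omega> \<in> space M \<Longrightarrow> u 0 \<omega> = u0"
    and "\<And>k. AE \<omega> in M. u k \<omega> \<in> D"
    and "\<And>k. AE \<omega> in M.
           is_arg_min (irgnm_objective F F' u0 (\<alpha> k) (P k \<omega>) (Z k \<omega>) (u k \<omega>)) (\<lambda>v. v \<in> UNIV)
             (u (Suc k) \<omega>)"
    and "\<And>k. integrable M (\<lambda>\<omega>. (norm (u k \<omega> - ud))\<^sup>2)"
    and "\<And>k. integrable M (\<lambda>\<omega>. (norm (F (u k \<omega>) - yd))\<^sup>2)"
    and "\<And>k. integrable M (\<lambda>\<omega>. sketched_err_diff F F' ud (P k \<omega>) (Z k \<omega>) (u k \<omega>) (u (Suc k) \<omega>))"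
    and "concave_index_function \<phi>"
    and "variational_source_condition F D ud u0 \<phi>"
    and "C \<ge> 1" and "\<eta> > 0"
    and "tangential_cone_condition F F' D yd C \<eta>"
  shows "ereal (\<alpha> n * mean_sq_error M ud (u (Suc n))
                + 1 / (2 * C) * mean_sq_residual M F yd (u (Suc n)))
           \<le> ereal (prob_space.expectation M
                 (\<lambda>\<omega>. sketched_err_diff F F' ud (P n \<omega>) (Z n \<omega>) (u n \<omega>) (u (Suc n) \<omega>)))
              + ereal (\<alpha> n) * Psi \<phi> (2 * C * \<alpha> n)
              + ereal (2 * \<eta> * mean_sq_residual M F yd (u n))
         \<and> Psi \<phi> (2 * C * \<alpha> n) = (SUP \<tau>\<in>{0..}. ereal (\<phi> \<tau> - \<tau> / (2 * C * \<alpha> n)))"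
proof
  interpret prob_space M by fact
  show "Psi \<phi> (2 * C * \<alpha> n) = (SUP \<tau>\<in>{0..}. ereal (\<phi> \<tau> - \<tau> / (2 * C * \<alpha> n)))"
    by (rule Psi_eq_SUP)
  note ad = \<open>\<And>k. AE \<omega> in M. u k \<omega> \<in> D\<close>
  note amin = \<open>\<And>k. AE \<omega> in M. is_arg_min (irgnm_objective F F' u0 (\<alpha> k) (P k \<omega>) (Z k \<omega>) (u k \<omega>))
    (\<lambda>v. v \<in> UNIV) (u (Suc k) \<omega>)\<close>
  note int_d = \<open>\<And>k. integrable M (\<lambda>\<omega>. (norm (u k \<omega> - ud))\<^sup>2)\<close>
  note int_t = \<open>\<And>k. integrable M (\<lambda>\<omega>. (norm (F (u k \<omega>) - yd))\<^sup>2)\<close>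
  note int_e = \<open>\<And>k. integrable M (\<lambda>\<omega>. sketched_err_diff F F' ud (P k \<omega>) (Z k \<omega>) (u k \<omega>) (u (Suc k) \<omega>))\<close>
  have \<alpha>: "\<alpha> n > 0" by fact
  have "\<phi> 0 = 0"
    using \<open>concave_index_function \<phi>\<close> unfolding concave_index_function_def by blast
  then have "0 \<le> Psi \<phi> (2 * C * \<alpha> n)" by (rule Psi_nonneg)
  then consider (fin) p where "Psi \<phi> (2 * C * \<alpha> n) = ereal p" | (inf) "Psi \<phi> (2 * C * \<alpha> n) = \<infinity>"
    by (cases "Psi \<phi> (2 * C * \<alpha> n)") auto
  then show "ereal (\<alpha> n * mean_sq_error M ud (u (Suc n))
                + 1 / (2 * C) * mean_sq_residual M F yd (u (Suc n)))
           \<le> ereal (prob_space.expectation M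
                 (\<lambda>\<omega>. sketched_err_diff F F' ud (P n \<omega>) (Z n \<omega>) (u n \<omega>) (u (Suc n) \<omega>)))
              + ereal (\<alpha> n) * Psi \<phi> (2 * C * \<alpha> n)
              + ereal (2 * \<eta> * mean_sq_residual M F yd (u n))"
  proof cases
    case inf
    \<comment> \<open>A positive multiple of infinity is infinite, so the right-hand side is
      infinite.\<close>
    then show ?thesis using \<alpha> by simp
  next
    case fin
    let ?lhs = "\<lambda>\<omega>. \<alpha> n * (norm (u (Suc n) \<omega> - ud))\<^sup>2
      + 1 / (2 * C) * (1/2 * (norm (F (u (Suc n) \<omega>) - yd))\<^sup>2)"
    let ?rhs = "\<lambda>\<omega>. sketched_err_diff F F' ud (P n \<omega>) (Z n \<omega>) (u n \<omega>) (u (Suc n) \<omega>)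
      + \<alpha> n * p + 2 * \<eta> * (1/2 * (norm (F (u n \<omega>) - yd))\<^sup>2)"
    have pointwise: "AE \<omega> in M. ?lhs \<omega> \<le> ?rhs \<omega>"
      using ad[of n] ad[of "Suc n"] amin[of n]
    proof eventually_elim
      case (elim \<omega>)
      \<comment> \<open>The minimum is over the whole space, so \<open>ud\<close> is an admissible
        competitor.\<close>
      have "irgnm_objective F F' u0 (\<alpha> n) (P n \<omega>) (Z n \<omega>) (u n \<omega>) (u (Suc n) \<omega>)
          \<le> irgnm_objective F F' u0 (\<alpha> n) (P n \<omega>) (Z n \<omega>) (u n \<omega>) ud"
        using elim(3) unfolding is_arg_min_linorder by blast
      moreover have "\<phi> \<tau> - \<tau> / (2 * C * \<alpha> n) \<le> p" if "0 \<le> \<tau>" for \<tau>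
        using Psi_upper[OF that, of \<phi> "2 * C * \<alpha> n"] fin by simp
      ultimately show ?case
        unfolding \<open>yd = F ud\<close>
        using elim(1,2) \<alpha> \<open>C \<ge> 1\<close> \<open>ud \<in> D\<close> \<open>variational_source_condition F D ud u0 \<phi>\<close>
          \<open>tangential_cone_condition F F' D yd C \<eta>\<close>
        by (intro irgnm_step_estimate) (auto simp: \<open>yd = F ud\<close>)
    qed
    have "expectation ?lhs \<le> expectation ?rhs"
      using pointwise by (intro integral_mono_AE) (auto intro!: int_d int_t int_e)
    also have "expectation ?lhs = \<alpha> n * mean_sq_error M ud (u (Suc n))
        + 1 / (2 * C) * mean_sq_residual M F yd (u (Suc n))"
      unfolding mean_sq_error_def mean_sq_residual_def using int_d int_t by simp
    \<comment> \<open>The constant \<open>\<alpha> n * p\<close> is its own expectation since the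
      total mass is 1.\<close>
    also have "expectation ?rhs
        = expectation (\<lambda>\<omega>. sketched_err_diff F F' ud (P n \<omega>) (Z n \<omega>) (u n \<omega>) (u (Suc n) \<omega>))
          + \<alpha> n * p + 2 * \<eta> * mean_sq_residual M F yd (u n)"
      unfolding mean_sq_residual_def using int_e int_t by (simp add: prob_space)
    finally show ?thesis by (simp add: fin)
  qed
qed

end
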